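(* Let $G$ be a group such that every element of $G$ has a square root in $G$ (for every $g\in G$ there is $h\in G$ with $h^2=g$). Then $G$ is natural.
   Context: Groups are abstract and of arbitrary cardinality. A metric $d$ on $G$ is right-invariant if $d(xg,yg)=d(x,y)$ for all $x,y,g\in G$. An isometry is a surjective distance-preserving map. A right-invariant metric $d$ on $G$ is naturalizing if every group law on the underlying set of $G$ (possibly with a different identity element) all of whose right translations are isometries of $d$ is abstractly isomorphic to $G$. A group is natural if it admits a naturalizing right-invariant metric. *)

theory Defs
  imports "HOL-Analysis.Abstract_Metric_Spaces" "HOL-Algebra.Group"
begin

definition right_invariant :: "('a, 'm) monoid_scheme \<Rightarrow> ('a \<Rightarrow> 'a \<Rightarrow> real) \<Rightarrow> bool" where
  "right_invariant G d \<longleftrightarrow>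
    (\<forall>x\<in>carrier G. \<forall>y\<in>carrier G. \<forall>g\<in>carrier G. d (x \<otimes>\<^bsub>G\<^esub> g) (y \<otimes>\<^bsub>G\<^esub> g) = d x y)"

definition isometry_on :: "'a set \<Rightarrow> ('a \<Rightarrow> 'a \<Rightarrow> real) \<Rightarrow> ('a \<Rightarrow> 'a) \<Rightarrow> bool" where
  "isometry_on M d f \<longleftrightarrow> f ` M = M \<and> (\<forall>x\<in>M. \<forall>y\<in>M. d (f x) (f y) = d x y)"

definition right_translation :: "('a, 'm) monoid_scheme \<Rightarrow> 'a \<Rightarrow> 'a \<Rightarrow> 'a" where
  "right_translation G g = (\<lambda>x. x \<otimes>\<^bsub>G\<^esub> g)"

(* A group law on the underlying set of G is a group structure H with the same carrier;
   neither its product nor its unit is otherwise related to that of G. *)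
definition naturalizing :: "('a, 'm) monoid_scheme \<Rightarrow> ('a \<Rightarrow> 'a \<Rightarrow> real) \<Rightarrow> bool" where
  "naturalizing G d \<longleftrightarrow>
    Metric_space (carrier G) d \<and> right_invariant G d \<and>
    (\<forall>H :: 'a monoid.
      group H \<and> carrier H = carrier G \<and>
      (\<forall>h\<in>carrier H. isometry_on (carrier G) d (right_translation H h)) \<longrightarrow> H \<cong> G)"

definition natural_group :: "('a, 'm) monoid_scheme \<Rightarrow> bool" where
  "natural_group G \<longleftrightarrow> group G \<and> (\<exists>d. naturalizing G d)"

end

theory Submission
  imports Defs "HOL-Algebra.Generated_Groups"
begin

text \<open>
  For a colouring \<open>c\<close> of \<open>G\<close> with \<open>c g = c (inv g)\<close> the function
  \<open>1 + 1 / (1 + c (x \<otimes> inv y))\<close>, for \<open>x \<noteq> y\<close>, is a right-invariant metric, the triangle inequality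
  being automatic for values in \<open>{1..2}\<close>, and its isometries are the
  \<open>c\<close>-preserving bijections. Countably many colours suffice, whatever the cardinality of \<open>G\<close>, to force
  every such bijection \<open>f\<close> to satisfy \<open>f x \<otimes> inv (f y) = (x \<otimes> inv y)\<^sup>\<plusminus>\<^sup>1\<close>.
  Indeed, take a well-ordered generating set \<open>T\<close> none of whose elements is generated by its
  predecessors, and colour \<open>g\<close> by whether \<open>g \<in> T\<^sup>\<plusminus>\<^sup>1\<close> and by the parity of its level, the first stage
  at which \<open>g\<close> is generated. Since the level of \<open>s \<otimes> inv t\<close> is the larger of two distinct levels, this
  encodes the order of \<open>T\<close>, so an isometry fixing \<open>\<one>\<close> fixes every \<open>t \<in> T\<close> up to inversion.
  Applied to all translates, this shows that it preserves each subgroup generated by a subset of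
  \<open>T\<close>. The elements lying in exactly the same such subgroups form countable classes, on which
  a second colour can be taken injective up to inversion.

  Finally, let \<open>f\<close> be a fixed-point-free isometry, \<open>g = f \<one>\<close> and \<open>k x = f x \<otimes> inv g\<close>, so that
  \<open>k x = x\<^sup>\<plusminus>\<^sup>1\<close>. A square root \<open>h\<close> of \<open>g\<close> has \<open>k h = h\<close>, as \<open>k h = inv h\<close> would make \<open>h\<close> a fixed
  point of \<open>f\<close>. If \<open>k x \<noteq> x\<close>, then \<open>x\<close> inverts by conjugation every \<open>y\<close> with \<open>k y \<noteq> inv y\<close>, and a square root
  of \<open>x\<close> yields a contradiction. Hence \<open>f\<close> is a translation.
\<close>

section \<open>Square roots and maps that preserve quotients up to inversion\<close>

lemma (in group) quotient_cancel_right: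
  assumes "x \<in> carrier G" "y \<in> carrier G" "z \<in> carrier G"
  shows "(x \<otimes> z) \<otimes> inv (y \<otimes> z) = x \<otimes> inv y"
proof -
  have "(x \<otimes> z) \<otimes> inv (y \<otimes> z) = x \<otimes> ((z \<otimes> inv z) \<otimes> inv y)"
    using assms by (simp only: inv_mult_group m_assoc m_closed inv_closed)
  then show ?thesis using assms by simp
qed

lemma (in group) quotient_mult_quotient:
  assumes "x \<in> carrier G" "y \<in> carrier G" "z \<in> carrier G"
  shows "(x \<otimes> inv y) \<otimes> (y \<otimes> inv z) = x \<otimes> inv z"
proof -
  have "(x \<otimes> inv y) \<otimes> (y \<otimes> inv z) = x \<otimes> ((inv y \<otimes> y) \<otimes> inv z)"
    using assms by (simp only: m_assoc m_closed inv_closed)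
  then show ?thesis using assms by simp
qed

text \<open>Square roots enter twice. A root of \<open>f \<one>\<close> gives an element that
  \<open>k\<close> does not invert; a root of a hypothetical \<open>x\<close> moved by
  \<open>k\<close> then yields the contradiction, whichever way \<open>k\<close> treats that
  root.\<close>

lemma (in group) fixed_point_free_inversion_is_translation:
  assumes roots: "\<And>g. g \<in> carrier G \<Longrightarrow> \<exists>h\<in>carrier G. h \<otimes> h = g"
    and closed: "\<And>x. x \<in> carrier G \<Longrightarrow> f x \<in> carrier G"
    and quot: "\<And>x y. \<lbrakk>x \<in> carrier G; y \<in> carrier G\<rbrakk>
      \<Longrightarrow> f x \<otimes> inv (f y) \<in> {x \<otimes> inv y, inv (x \<otimes> inv y)}"
    and free: "\<And>x. x \<in> carrier G \<Longrightarrow> f x \<noteq> x"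
    and x: "x \<in> carrier G"
  shows "f x = x \<otimes> f \<one>"
proof -
  define g where "g = f \<one>"
  have gC: "g \<in> carrier G" using closed g_def by simp
  define k where "k = (\<lambda>x. f x \<otimes> inv g)"
  have kC: "k x \<in> carrier G" if "x \<in> carrier G" for x
    using that closed gC k_def by simp
  have fk: "f x = k x \<otimes> g" if "x \<in> carrier G" for x
    using that closed gC k_def by (simp add: m_assoc)
  have k_cases: "k x = x \<or> k x = inv x" if "x \<in> carrier G" for x
    using quot[OF that one_closed] that by (auto simp: k_def g_def)
  have k_quot: "k x \<otimes> inv (k y) \<in> {x \<otimes> inv y, inv (x \<otimes> inv y)}"
    if "x \<in> carrier G" "y \<in> carrier G" for x y
  proof -
    have "k x \<otimes> inv (k y) = f x \<otimes> inv (f y)"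
      unfolding k_def using that closed gC by (intro quotient_cancel_right) auto
    then show ?thesis using quot[OF that] by simp
  qed
  \<comment> \<open>Here \<open>k x = inv x\<close> and \<open>k y = y\<close>, so
    \<open>inv x \<otimes> inv y\<close> is \<open>x \<otimes> inv y\<close> or its inverse. The
    former would give \<open>inv x = x = k x\<close>; the latter is the claim after multiplying by
    \<open>x\<close> on both sides.\<close>
  have conj: "x \<otimes> y = inv y \<otimes> x"
    if xy: "x \<in> carrier G" "y \<in> carrier G" "k x \<noteq> x" "k y \<noteq> inv y" for x y
  proof -
    have kx: "k x = inv x" and ky: "k y = y" using k_cases xy by blast+
    have "inv x \<otimes> inv y \<in> {x \<otimes> inv y, inv (x \<otimes> inv y)}"
      using k_quot[OF xy(1,2)] kx ky by simp
    moreover have "inv x \<otimes> inv y \<noteq> x \<otimes> inv y"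
      using xy kx by simp
    ultimately have "inv x \<otimes> inv y = y \<otimes> inv x"
      using xy by (simp add: inv_mult_group)
    then have "x \<otimes> (inv x \<otimes> inv y) \<otimes> x = x \<otimes> (y \<otimes> inv x) \<otimes> x" by simp
    moreover have "x \<otimes> (inv x \<otimes> inv y) \<otimes> x = inv y \<otimes> x"
      using xy by (simp add: m_assoc[symmetric])
    moreover have "x \<otimes> (y \<otimes> inv x) \<otimes> x = x \<otimes> y" using xy by (simp add: m_assoc)
    ultimately show ?thesis by simp
  qed
  have g1: "g \<noteq> \<one>" using free[of \<one>] g_def by simp
  obtain h where h: "h \<in> carrier G" "h \<otimes> h = g" using roots gC by blast
  have kh: "k h \<noteq> inv h"
  proof
    assume "k h = inv h"
    then have "f h = inv h \<otimes> (h \<otimes> h)" using fk h by simp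
    also have "\<dots> = h" using h(1) by (simp add: m_assoc[symmetric])
    finally have "f h = h" .
    then show False using free h by blast
  qed
  have "k x = x"
  proof (rule ccontr)
    assume kx: "k x \<noteq> x"
    have xh: "x \<otimes> h = inv h \<otimes> x" using conj[OF x h(1) kx kh] .
    obtain s where s: "s \<in> carrier G" "s \<otimes> s = x" using roots x by blast
    have x1: "x \<noteq> \<one>" using kx k_cases[OF x] by auto
    show False
    proof (cases "k s = s")
      \<comment> \<open>Both \<open>s\<close> and \<open>x\<close> invert \<open>h\<close> under
        conjugation. But \<open>x\<close> is the square of \<open>s\<close>, so it also commutes
        with \<open>h\<close>; hence \<open>h\<close> is its own inverse and
        \<open>g = \<one>\<close>.\<close>
      case False
      have sh: "s \<otimes> h = inv h \<otimes> s" using conj[OF s(1) h(1) False kh] .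
      have "h \<otimes> (s \<otimes> h) \<otimes> inv h = h \<otimes> (inv h \<otimes> s) \<otimes> inv h" using sh by simp
      moreover have "h \<otimes> (s \<otimes> h) \<otimes> inv h = h \<otimes> s" using s h(1) by (simp add: m_assoc)
      moreover have "h \<otimes> (inv h \<otimes> s) \<otimes> inv h = s \<otimes> inv h"
        using s h(1) by (simp add: m_assoc[symmetric])
      ultimately have hs: "s \<otimes> inv h = h \<otimes> s" by simp
      have "s \<otimes> s \<otimes> h = s \<otimes> (inv h \<otimes> s)" using sh s(1) h(1) by (simp add: m_assoc)
      also have "\<dots> = h \<otimes> s \<otimes> s" using hs s(1) h(1) by (simp add: m_assoc[symmetric])
      also have "\<dots> = h \<otimes> (s \<otimes> s)" using s(1) h(1) by (simp add: m_assoc)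
      finally have "x \<otimes> h = h \<otimes> x" using s by simp
      then have "h \<otimes> x = inv h \<otimes> x" using xh by simp
      then have "h = inv h" using x h(1) by simp
      then have "h \<otimes> h = \<one>" using h(1) by (metis r_inv)
      then show False using g1 h by simp
    next
      \<comment> \<open>Now \<open>s\<close> is fixed by \<open>k\<close> and is not an involution,
        so \<open>x\<close> inverts \<open>s\<close> under conjugation, although \<open>x\<close>, a
        power of \<open>s\<close>, commutes with it.\<close>
      case True
      have ss: "s \<otimes> s \<noteq> \<one>" using s x1 by simp
      then have "s \<noteq> inv s" using s(1) by (metis r_inv)
      then have "k s \<noteq> inv s" using True by simp
      then have "x \<otimes> s = inv s \<otimes> x" using conj[OF x s(1) kx] by simp
      moreover have "x \<otimes> s = s \<otimes> x" using s m_assoc by metis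
      ultimately have "s = inv s" using x s(1) by simp
      then show False using \<open>s \<noteq> inv s\<close> by simp
    qed
  qed
  then show ?thesis using fk[OF x] g_def by simp
qed

section \<open>A colouring determined by a transfinite sequence of generators\<close>

lemma (in group) countable_generate:
  assumes F: "countable F" "F \<subseteq> carrier G"
  shows "countable (generate G F)"
proof -
  \<comment> \<open>Each element of the generated subgroup is the value of a finite word in the
    generators and their inverses, and a countable alphabet has only countably many words.\<close>
  let ?L = "lists (F \<union> m_inv G ` F)"
  let ?p = "\<lambda>l. foldr (\<otimes>) l \<one>"
  have C: "F \<union> m_inv G ` F \<subseteq> carrier G" using F by auto
  have pC: "?p l \<in> carrier G" if "l \<in> ?L" for l
    using that C by (induction l) auto
  have p_append: "?p (l @ m) = ?p l \<otimes> ?p m" if "l \<in> ?L" "m \<in> ?L" for l m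
    using that
  proof (induction l)
    case Nil
    then show ?case using pC by simp
  next
    case (Cons a l)
    have "a \<in> F \<union> m_inv G ` F" using Cons.hyps by simp
    then have "a \<in> carrier G" using C by blast
    then show ?case using Cons pC by (auto simp: m_assoc)
  qed
  have "g \<in> ?p ` ?L" if "g \<in> generate G F" for g
    using that
  proof (induction rule: generate.induct)
    case one
    then show ?case by (intro image_eqI[of _ _ "[]"]) auto
  next
    case (incl h)
    then show ?case using C by (intro image_eqI[of _ _ "[h]"]) auto
  next
    case (inv h)
    then show ?case using C F by (intro image_eqI[of _ _ "[inv h]"]) auto
  next
    case (eng h1 h2)
    then obtain l m where "l \<in> ?L" "m \<in> ?L" "h1 = ?p l" "h2 = ?p m" by blast
    then show ?case using p_append by (intro image_eqI[of _ _ "l @ m"]) auto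
  qed
  then have "generate G F \<subseteq> ?p ` ?L" by blast
  moreover have "countable ?L" using F by (intro countable_lists) auto
  ultimately show ?thesis using countable_subset countable_image by metis
qed

lemma (in group) generate_finitary:
  assumes "g \<in> generate G T"
  shows "\<exists>F. finite F \<and> F \<subseteq> T \<and> g \<in> generate G F"
  using assms
proof (induction rule: generate.induct)
  case one
  then show ?case by (intro exI[of _ "{}"]) (auto intro: generate.one)
next
  case (incl h)
  then show ?case by (intro exI[of _ "{h}"]) (auto intro: generate.incl)
next
  case (inv h)
  then show ?case by (intro exI[of _ "{h}"]) (auto intro: generate.inv)
next
  case (eng h1 h2)
  then obtain A B where "finite A" "A \<subseteq> T" "h1 \<in> generate G A"
    and "finite B" "B \<subseteq> T" "h2 \<in> generate G B" by blast
  moreover have "generate G A \<subseteq> generate G (A \<union> B)" "generate G B \<subseteq> generate G (A \<union> B)"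
    by (simp_all add: mono_generate)
  ultimately show ?case
    by (intro exI[of _ "A \<union> B"]) (auto intro: generate.eng)
qed

section \<open>Levels with respect to a well-order\<close>

locale well_ordered_group = group G for G :: "('a, 'b) monoid_scheme" (structure) +
  fixes less :: "'a \<Rightarrow> 'a \<Rightarrow> bool" (infix "\<lless>" 50)
  assumes wf_less: "wf {(x, y). x \<lless> y}"
    and trans_less: "x \<lless> y \<Longrightarrow> y \<lless> z \<Longrightarrow> x \<lless> z"
    and total_less: "x \<noteq> y \<Longrightarrow> x \<lless> y \<or> y \<lless> x"
begin

lemma least_exists:
  assumes "Q x"
  shows "\<exists>m. Q m \<and> (\<forall>y. y \<lless> m \<longrightarrow> \<not> Q y)"
  using wfE_min[OF wf_less, of x "Collect Q"] assms by (metis (mono_tags) case_prodI mem_Collect_eq)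

definition below :: "'a \<Rightarrow> 'a set" where
  "below t = generate G {s \<in> carrier G. s \<lless> t}"

definition upto :: "'a \<Rightarrow> 'a set" where
  "upto t = generate G {s \<in> carrier G. s \<lless> t \<or> s = t}"

text \<open>The transfinite greedy choice of generators: \<open>t\<close> is kept unless all its
  predecessors, kept or not, already generate it.\<close>

definition gens :: "'a set" where
  "gens = {t \<in> carrier G. t \<notin> below t}"

definition is_level :: "'a \<Rightarrow> 'a \<Rightarrow> bool" where
  "is_level g t \<longleftrightarrow> g \<in> upto t \<and> (\<forall>u. u \<lless> t \<longrightarrow> g \<notin> upto u)"

definition level :: "'a \<Rightarrow> 'a" where
  "level g = (THE t. is_level g t)"

lemma subgroup_upto: "subgroup (upto t) G"
  unfolding upto_def by (rule generate_is_subgroup) auto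

lemma upto_mono: "u \<lless> t \<Longrightarrow> upto u \<subseteq> upto t"
  unfolding upto_def by (rule mono_generate) (use trans_less in blast)

lemma upto_subset_below: "u \<lless> t \<Longrightarrow> upto u \<subseteq> below t"
  unfolding upto_def below_def by (rule mono_generate) (use trans_less in blast)

lemma is_level_unique: "is_level g t \<Longrightarrow> is_level g u \<Longrightarrow> t = u"
  unfolding is_level_def using total_less by blast

lemma levelI: "is_level g t \<Longrightarrow> level g = t"
  unfolding level_def using is_level_unique by blast

lemma is_level_level:
  assumes "g \<in> carrier G"
  shows "is_level g (level g)"
proof -
  have "g \<in> upto g" unfolding upto_def using assms by (intro generate.incl) auto
  then obtain t where "is_level g t"
    using least_exists[of "\<lambda>t. g \<in> upto t"] unfolding is_level_def by blast
  then show ?thesis using levelI by metis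
qed

lemma level_inv:
  assumes "g \<in> carrier G"
  shows "level (inv g) = level g"
proof -
  have "inv g \<in> upto t \<longleftrightarrow> g \<in> upto t" for t
    using subgroup_upto[of t] assms by (metis inv_inv subgroup.m_inv_closed)
  then have "is_level (inv g) (level g)"
    using is_level_level[OF assms] unfolding is_level_def by simp
  then show ?thesis by (rule levelI)
qed

lemma level_quotient:
  assumes x: "x \<in> carrier G" and y: "y \<in> carrier G" and lt: "level x \<lless> level y"
  shows "level (x \<otimes> inv y) = level y"
proof (rule levelI, unfold is_level_def, intro conjI allI impI)
  have xy: "x \<in> upto (level x)" "y \<in> upto (level y)"
    using is_level_level x y unfolding is_level_def by blast+
  then show "x \<otimes> inv y \<in> upto (level y)"
    using upto_mono[OF lt] subgroup_upto by (meson subgroup.m_closed subgroup.m_inv_closed subsetD)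
  fix u assume u: "u \<lless> level y"
  show "x \<otimes> inv y \<notin> upto u"
  proof
    assume a: "x \<otimes> inv y \<in> upto u"
    \<comment> \<open>\<open>v\<close> is the later of \<open>u\<close> and \<open>level x\<close>;
      were the quotient present at stage \<open>u\<close>, then \<open>y\<close> would already
      appear at stage \<open>v\<close>, before its level.\<close>
    obtain v where v: "v \<lless> level y" "upto u \<subseteq> upto v" "upto (level x) \<subseteq> upto v"
      using u lt upto_mono total_less[of u "level x"] by blast
    have "inv (x \<otimes> inv y) \<otimes> x \<in> upto v"
      using subgroup_upto[of v] v a xy by (meson subgroup.m_closed subgroup.m_inv_closed subsetD)
    moreover have "inv (x \<otimes> inv y) \<otimes> x = y"
      using x y by (simp add: inv_mult_group m_assoc)
    ultimately show False
      using is_level_level[OF y] v unfolding is_level_def by simp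
  qed
qed

lemma level_gens:
  assumes "t \<in> gens"
  shows "level t = t"
proof (rule levelI, unfold is_level_def, intro conjI allI impI)
  show "t \<in> upto t" unfolding upto_def using assms gens_def by (intro generate.incl) auto
  show "t \<notin> upto u" if "u \<lless> t" for u
    using upto_subset_below[OF that] assms gens_def by auto
qed

lemma gens_carrier: "gens \<subseteq> carrier G"
  by (auto simp: gens_def)

text \<open>Well-founded induction: a discarded element is generated by its predecessors, which are
  generated by \<open>gens\<close> already.\<close>

lemma gens_generate: "t \<in> carrier G \<Longrightarrow> t \<in> generate G gens"
proof (induction t rule: wf_induct_rule[OF wf_less])
  case (1 t)
  show ?case
  proof (cases "t \<in> gens")
    case True
    then show ?thesis by (rule generate.incl)
  next
    case False
    then have "t \<in> below t" using 1 by (simp add: gens_def)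
    moreover have "below t \<subseteq> generate G gens"
      unfolding below_def
      by (rule generate_subgroup_incl)
         (use 1 generate_is_subgroup[OF gens_carrier] in auto)
    ultimately show ?thesis by blast
  qed
qed

section \<open>Parity along the generators\<close>

definition cover :: "'a \<Rightarrow> 'a \<Rightarrow> bool" where
  "cover s t \<longleftrightarrow> s \<in> gens \<and> s \<lless> t \<and> \<not> (\<exists>u\<in>gens. s \<lless> u \<and> u \<lless> t)"

text \<open>The parity of an ordinal position: it flips from a generator to the next one and
  restarts at \<open>False\<close> where no immediate predecessor in \<open>gens\<close>
  exists.\<close>

definition parity :: "'a \<Rightarrow> bool" where
  "parity = wfrec {(x, y). x \<lless> y} (\<lambda>p t. \<exists>s. cover s t \<and> \<not> p s)"

lemma parity_iff: "parity t \<longleftrightarrow> (\<exists>s. cover s t \<and> \<not> parity s)"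
proof -
  have "parity t \<longleftrightarrow> (\<exists>s. cover s t \<and> \<not> cut parity {(x, y). x \<lless> y} t s)"
    unfolding parity_def by (subst wfrec[OF wf_less]) simp
  then show ?thesis by (auto simp: cut_def cover_def)
qed

text \<open>The generator \<open>u\<close> next after \<open>s\<close> has \<open>s\<close> as its
  only cover, so its parity is opposite. It differs from \<open>t\<close>, whose parity is that of
  \<open>s\<close>, and therefore lies before \<open>t\<close>.\<close>

lemma parity_interpolate:
  assumes s: "s \<in> gens" and t: "t \<in> gens" and lt: "s \<lless> t" and eq: "parity s = parity t"
  shows "\<exists>u\<in>gens. s \<lless> u \<and> u \<lless> t \<and> parity u \<noteq> parity s"
proof -
  obtain u where u: "u \<in> gens" "s \<lless> u" and min: "\<And>v. v \<lless> u \<Longrightarrow> \<not> (v \<in> gens \<and> s \<lless> v)"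
    using least_exists[of "\<lambda>v. v \<in> gens \<and> s \<lless> v" t] t lt by blast
  have su: "cover s u" unfolding cover_def using s u min by blast
  have "v = s" if "cover v u" for v
    using that su total_less[of v s] unfolding cover_def by blast
  then have pu: "parity u \<noteq> parity s" using parity_iff[of u] su by blast
  then have "u \<noteq> t" using eq by auto
  moreover have "\<not> t \<lless> u" using min[of t] t lt by blast
  ultimately show ?thesis using total_less[of u t] u pu by blast
qed

section \<open>Maps preserving generators and parity of quotients\<close>

definition sgens :: "'a set" where
  "sgens = {x \<in> carrier G. x \<in> gens \<or> inv x \<in> gens}"

lemma sgens_carrier: "sgens \<subseteq> carrier G"
  by (auto simp: sgens_def)

lemma sgens_inv: "g \<in> carrier G \<Longrightarrow> inv g \<in> sgens \<longleftrightarrow> g \<in> sgens"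
  by (auto simp: sgens_def)

lemma sgens_cases:
  assumes "x \<in> sgens"
  shows "level x \<in> gens" and "x = level x \<or> x = inv (level x)"
proof -
  have C: "x \<in> carrier G" using assms sgens_carrier by blast
  have "x \<in> gens \<or> inv x \<in> gens" using assms sgens_def by blast
  moreover have "level x = inv x" if "inv x \<in> gens"
    using level_gens[OF that] level_inv[OF C] by simp
  ultimately show "level x \<in> gens" "x = level x \<or> x = inv (level x)"
    using level_gens C by auto
qed

text \<open>The level of a quotient is the larger of the two levels. When their parities differ, the
  parity of the quotient alone reveals which one is larger.\<close>

lemma level_less_iff:
  assumes "x \<in> carrier G" "y \<in> carrier G" "parity (level x) \<noteq> parity (level y)"
  shows "level x \<lless> level y \<longleftrightarrow> parity (level (x \<otimes> inv y)) = parity (level y)"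
proof (cases "level x \<lless> level y")
  case True
  then show ?thesis using level_quotient assms by simp
next
  case False
  then have "level y \<lless> level x" using total_less assms by metis
  then have "level (y \<otimes> inv x) = level x" using level_quotient assms by simp
  moreover have "inv (y \<otimes> inv x) = x \<otimes> inv y" using assms by (simp add: inv_mult_group)
  moreover have "level (inv (y \<otimes> inv x)) = level (y \<otimes> inv x)"
    using assms by (intro level_inv) auto
  ultimately show ?thesis using False assms by metis
qed

text \<open>What the first two components of the colour impose on a colour-preserving bijection.
  \<open>f \<one> = \<one>\<close> is not demanded, so that the notion is stable under translation
  on both sides.\<close>

definition gen_preserving :: "('a \<Rightarrow> 'a) \<Rightarrow> bool" where
  "gen_preserving f \<longleftrightarrow> bij_betw f (carrier G) (carrier G) \<and>
    (\<forall>x\<in>carrier G. \<forall>y\<in>carrier G.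
      (f x \<otimes> inv (f y) \<in> sgens \<longleftrightarrow> x \<otimes> inv y \<in> sgens) \<and>
      parity (level (f x \<otimes> inv (f y))) = parity (level (x \<otimes> inv y)))"

lemma gen_preserving_closed: "gen_preserving f \<Longrightarrow> x \<in> carrier G \<Longrightarrow> f x \<in> carrier G"
  unfolding gen_preserving_def by (auto dest: bij_betwE)

lemma gen_preserving_inverse:
  assumes "gen_preserving f"
  shows "gen_preserving (inv_into (carrier G) f)"
proof -
  let ?k = "inv_into (carrier G) f"
  have b: "bij_betw f (carrier G) (carrier G)" using assms gen_preserving_def by blast
  then have k: "bij_betw ?k (carrier G) (carrier G)" by (rule bij_betw_inv_into)
  have "?k x \<in> carrier G" "f (?k x) = x" if "x \<in> carrier G" for x
    using b k that by (auto dest: bij_betwE simp: bij_betw_inv_into_right)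
  then show ?thesis using assms k unfolding gen_preserving_def by metis
qed

lemma gen_preserving_translate:
  assumes f: "gen_preserving f" and z: "z \<in> carrier G" and w: "w \<in> carrier G"
  shows "gen_preserving (\<lambda>y. f (y \<otimes> z) \<otimes> w)"
proof -
  have tr: "bij_betw (\<lambda>y. y \<otimes> a) (carrier G) (carrier G)" if "a \<in> carrier G" for a
    using that by (intro bij_betw_byWitness[where f' = "\<lambda>y. y \<otimes> inv a"]) (auto simp: m_assoc)
  have b: "bij_betw f (carrier G) (carrier G)" using f gen_preserving_def by blast
  have "bij_betw (\<lambda>y. f (y \<otimes> z) \<otimes> w) (carrier G) (carrier G)"
    using bij_betw_trans[OF bij_betw_trans[OF tr[OF z] b] tr[OF w]] by (simp add: o_def)
  then show ?thesis
    using f z w gen_preserving_closed[OF f] unfolding gen_preserving_def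
    by (simp add: quotient_cancel_right)
qed

lemma gen_preserving_inverse_one:
  assumes "gen_preserving f" "f \<one> = \<one>"
  shows "inv_into (carrier G) f \<one> = \<one>"
  using assms bij_betw_inv_into_left[of f "carrier G" "carrier G" \<one>]
  unfolding gen_preserving_def by simp

lemma gen_preserving_image:
  assumes f: "gen_preserving f" "f \<one> = \<one>" and x: "x \<in> sgens"
  shows "f x \<in> sgens" and "parity (level (f x)) = parity (level x)"
proof -
  have C: "x \<in> carrier G" using x sgens_carrier by blast
  then have "(f x \<otimes> inv (f \<one>) \<in> sgens \<longleftrightarrow> x \<otimes> inv \<one> \<in> sgens) \<and>
    parity (level (f x \<otimes> inv (f \<one>))) = parity (level (x \<otimes> inv \<one>))"
    using f(1) unfolding gen_preserving_def by blast
  then show "f x \<in> sgens" "parity (level (f x)) = parity (level x)"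
    using f C x gen_preserving_closed by auto
qed

lemma gen_preserving_level_mono:
  assumes f: "gen_preserving f" "f \<one> = \<one>"
    and xy: "x \<in> sgens" "y \<in> sgens" "level x \<lless> level y"
  shows "level (f x) \<lless> level (f y)"
proof -
  have step: "level (f x) \<lless> level (f y)"
    if *: "x \<in> sgens" "y \<in> sgens" "level x \<lless> level y" "parity (level x) \<noteq> parity (level y)" for x y
  proof -
    have C: "x \<in> carrier G" "y \<in> carrier G" using * sgens_carrier by blast+
    then have "parity (level (f x \<otimes> inv (f y))) = parity (level (x \<otimes> inv y))"
      using f(1) unfolding gen_preserving_def by blast
    then show ?thesis
      using level_less_iff[OF C *(4)] level_less_iff[of "f x" "f y"] gen_preserving_image[OF f] * C
        gen_preserving_closed[OF f(1)] by simp
  qed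
  show ?thesis
  proof (cases "parity (level x) = parity (level y)")
    case True
    \<comment> \<open>Equal parities say nothing directly, so the comparison passes through a
      generator of the other parity lying strictly between.\<close>
    then obtain u where u: "u \<in> gens" "level x \<lless> u" "u \<lless> level y" "parity u \<noteq> parity (level x)"
      using parity_interpolate sgens_cases(1) xy by metis
    have "u \<in> sgens" "level u = u" using u gens_carrier level_gens sgens_def by auto
    then show ?thesis using step[of x u] step[of u y] u xy True trans_less by metis
  next
    case False
    then show ?thesis using step xy by blast
  qed
qed

text \<open>An order-preserving self-map of a well-order never decreases: if \<open>y\<close> were a
  counterexample of least level, \<open>f y\<close> would be one of smaller level.\<close>

lemma gen_preserving_level_ge:
  assumes f: "gen_preserving f" "f \<one> = \<one>" and x: "x \<in> sgens"
  shows "\<not> level (f x) \<lless> level x"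
proof
  assume "level (f x) \<lless> level x"
  then obtain m where m: "\<exists>x\<in>sgens. level x = m \<and> level (f x) \<lless> m"
    and min: "\<And>u. u \<lless> m \<Longrightarrow> \<not> (\<exists>x\<in>sgens. level x = u \<and> level (f x) \<lless> u)"
    using least_exists[of "\<lambda>m. \<exists>x\<in>sgens. level x = m \<and> level (f x) \<lless> m" "level x"] x by blast
  then obtain y where y: "y \<in> sgens" "level y = m" "level (f y) \<lless> m" by blast
  have fy: "f y \<in> sgens" by (rule gen_preserving_image(1)[OF f y(1)])
  then have "level (f (f y)) \<lless> level (f y)"
    using gen_preserving_level_mono[OF f fy y(1)] y by simp
  then show False using min[OF y(3)] fy by blast
qed

text \<open>Neither \<open>f\<close> nor its inverse lowers levels, so \<open>f\<close> keeps them,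
  and the level determines an element of \<open>sgens\<close> up to inversion.\<close>

lemma gen_preserving_sgens:
  assumes f: "gen_preserving f" "f \<one> = \<one>" and x: "x \<in> sgens"
  shows "f x = x \<or> f x = inv x"
proof -
  let ?k = "inv_into (carrier G) f"
  have k: "gen_preserving ?k" "?k \<one> = \<one>"
    using gen_preserving_inverse gen_preserving_inverse_one f by blast+
  have C: "x \<in> carrier G" using x sgens_carrier by blast
  have kf: "?k (f x) = x"
    using f(1) bij_betw_inv_into_left C unfolding gen_preserving_def by metis
  have fx: "f x \<in> sgens" by (rule gen_preserving_image(1)[OF f x])
  have "\<not> level (f x) \<lless> level x" by (rule gen_preserving_level_ge[OF f x])
  moreover have "\<not> level (?k (f x)) \<lless> level (f x)" by (rule gen_preserving_level_ge[OF k fx])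
  ultimately have l: "level (f x) = level x" using total_less kf by metis
  have "level x \<in> carrier G" using sgens_cases(1)[OF x] gens_carrier by blast
  then show ?thesis using sgens_cases(2)[OF x] sgens_cases(2)[OF fx] l by (metis inv_inv)
qed

text \<open>\<open>f\<close> carries the coset of \<open>z\<close> into the coset of
  \<open>f z\<close>. The base point varies because a product \<open>h1 \<otimes> h2\<close> is
  handled by moving first from \<open>z\<close> to \<open>h2 \<otimes> z\<close>, then on by
  \<open>h1\<close>.\<close>

lemma gen_preserving_generate:
  assumes f: "gen_preserving f" and F: "F \<subseteq> gens" and y: "y \<in> generate G F"
    and z: "z \<in> carrier G"
  shows "f (y \<otimes> z) \<otimes> inv (f z) \<in> generate G F"
proof -
  have FC: "F \<subseteq> carrier G" using F gens_carrier by blast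
  have fC: "f x \<in> carrier G" if "x \<in> carrier G" for x using gen_preserving_closed f that by blast
  \<comment> \<open>The map \<open>\<lambda>y. f (y \<otimes> z) \<otimes> inv (f z)\<close> is
    again generator-preserving and fixes \<open>\<one>\<close>, so it fixes \<open>x\<close> up to
    inversion.\<close>
  have step: "f (x \<otimes> z) \<otimes> inv (f z) = x \<or> f (x \<otimes> z) \<otimes> inv (f z) = inv x"
    if "x \<in> sgens" "z \<in> carrier G" for x z
    using gen_preserving_sgens[OF gen_preserving_translate[OF f that(2)] _ that(1)]
      that fC by simp
  show ?thesis using y z
  proof (induction arbitrary: z rule: generate.induct)
    case one
    then show ?case using fC generate.one by simp
  next
    case (incl h)
    then have "h \<in> sgens" using F gens_carrier by (auto simp: sgens_def)
    then show ?case using step[of h z] incl by (auto intro: generate.incl generate.inv)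
  next
    case (inv h)
    then have h: "h \<in> sgens" "h \<in> carrier G" using F gens_carrier by (auto simp: sgens_def)
    then show ?case using step[of "inv h" z] sgens_inv[of h] inv
      by (auto intro: generate.incl generate.inv)
  next
    case (eng h1 h2)
    have h: "h1 \<in> carrier G" "h2 \<in> carrier G" using eng generate_in_carrier[OF FC] by blast+
    have hz: "h2 \<otimes> z \<in> carrier G" using h eng.prems by simp
    have "(f (h1 \<otimes> (h2 \<otimes> z)) \<otimes> inv (f (h2 \<otimes> z))) \<otimes> (f (h2 \<otimes> z) \<otimes> inv (f z)) \<in> generate G F"
      by (rule generate.eng[OF eng.IH(1)[OF hz] eng.IH(2)[OF eng.prems]])
    moreover have "(f (h1 \<otimes> (h2 \<otimes> z)) \<otimes> inv (f (h2 \<otimes> z))) \<otimes> (f (h2 \<otimes> z) \<otimes> inv (f z))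
        = f (h1 \<otimes> h2 \<otimes> z) \<otimes> inv (f z)"
      using h hz eng.prems fC by (subst quotient_mult_quotient) (auto simp: m_assoc)
    ultimately show ?case by simp
  qed
qed

section \<open>Countable hull classes and the full colour\<close>

definition same_hulls :: "'a \<Rightarrow> 'a \<Rightarrow> bool" where
  "same_hulls g h \<longleftrightarrow> (\<forall>F\<subseteq>gens. g \<in> generate G F \<longleftrightarrow> h \<in> generate G F)"

lemma gen_preserving_same_hulls:
  assumes f: "gen_preserving f" "f \<one> = \<one>" and g: "g \<in> carrier G"
  shows "same_hulls (f g) g"
  unfolding same_hulls_def
proof (intro allI impI)
  fix F assume F: "F \<subseteq> gens"
  let ?k = "inv_into (carrier G) f"
  have b: "bij_betw f (carrier G) (carrier G)" using f gen_preserving_def by blast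
  have k: "gen_preserving ?k" "?k \<one> = \<one>"
    using gen_preserving_inverse gen_preserving_inverse_one f by blast+
  have FC: "F \<subseteq> carrier G" using F gens_carrier by blast
  have imp: "h x \<in> generate G F" if h: "gen_preserving h" "h \<one> = \<one>" and x: "x \<in> generate G F" for h x
    using gen_preserving_generate[OF h(1) F x one_closed] h generate_in_carrier[OF FC x]
      gen_preserving_closed[OF h(1)] by simp
  show "f g \<in> generate G F \<longleftrightarrow> g \<in> generate G F"
    using imp[OF f] imp[OF k, of "f g"] bij_betw_inv_into_left[OF b g] by auto
qed

lemma same_hulls_inv:
  assumes "g \<in> carrier G"
  shows "same_hulls (inv g) g"
  unfolding same_hulls_def
proof (intro allI impI)
  fix F assume "F \<subseteq> gens"
  then have "F \<subseteq> carrier G" using gens_carrier by blast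
  then show "inv g \<in> generate G F \<longleftrightarrow> g \<in> generate G F"
    using generate_m_inv_closed assms by (metis inv_inv)
qed

text \<open>\<open>g\<close> lies in the subgroup generated by some finite part of
  \<open>gens\<close>; its whole class lies in that countable subgroup.\<close>

lemma countable_same_hulls:
  assumes "g \<in> carrier G"
  shows "countable {h. same_hulls h g}"
proof -
  obtain F where F: "finite F" "F \<subseteq> gens" "g \<in> generate G F"
    using generate_finitary[OF gens_generate[OF assms]] by blast
  then have "{h. same_hulls h g} \<subseteq> generate G F" unfolding same_hulls_def by blast
  moreover have "countable (generate G F)"
    using F gens_carrier by (intro countable_generate) (auto intro: countable_finite)
  ultimately show ?thesis by (rule countable_subset)
qed

definition index :: "'a \<Rightarrow> nat" where
  "index g = to_nat_on {h. same_hulls h g} g"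

text \<open>The minimum makes the colour invariant under inversion, at the price of determining an
  element of a class only up to inversion.\<close>

definition colour :: "'a \<Rightarrow> nat" where
  "colour g = to_nat (g \<in> sgens, parity (level g), min (index g) (index (inv g)))"

lemma colour_inv: "g \<in> carrier G \<Longrightarrow> colour (inv g) = colour g"
  by (simp add: colour_def sgens_inv level_inv min.commute)

lemma index_inj:
  assumes "g \<in> carrier G" "same_hulls h g" "index h = index g"
  shows "h = g"
proof -
  have "{x. same_hulls x h} = {x. same_hulls x g}"
    using assms(2) unfolding same_hulls_def by blast
  moreover have "inj_on (to_nat_on {h. same_hulls h g}) {h. same_hulls h g}"
    by (rule inj_on_to_nat_on[OF countable_same_hulls[OF assms(1)]])
  moreover have "same_hulls g g" by (simp add: same_hulls_def)
  ultimately show ?thesis using assms unfolding index_def inj_on_def by simp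
qed

lemma colour_preserving_quotient:
  assumes b: "bij_betw f (carrier G) (carrier G)"
    and col: "\<And>x y. x \<in> carrier G \<Longrightarrow> y \<in> carrier G
      \<Longrightarrow> colour (f x \<otimes> inv (f y)) = colour (x \<otimes> inv y)"
    and xy: "x \<in> carrier G" "y \<in> carrier G"
  shows "f x \<otimes> inv (f y) \<in> {x \<otimes> inv y, inv (x \<otimes> inv y)}"
proof -
  have fC: "f x \<in> carrier G" if "x \<in> carrier G" for x using b that by (auto dest: bij_betwE)
  have f: "gen_preserving f" using b col unfolding gen_preserving_def colour_def by simp
  define g where "g = x \<otimes> inv y"
  define h where "h = f x \<otimes> inv (f y)"
  have gC: "g \<in> carrier G" and hC: "h \<in> carrier G" using xy fC by (auto simp: g_def h_def)
  \<comment> \<open>Translating by \<open>y\<close> and by \<open>inv (f y)\<close> gives a map that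
    fixes \<open>\<one>\<close> and sends \<open>g\<close> to \<open>h\<close>.\<close>
  have "same_hulls (f (g \<otimes> y) \<otimes> inv (f y)) g"
    using gen_preserving_same_hulls[OF gen_preserving_translate[OF f xy(2)] _ gC]
      xy fC by simp
  then have hg: "same_hulls h g" using xy by (simp add: g_def h_def m_assoc)
  have tr: "same_hulls a b \<Longrightarrow> same_hulls c b \<Longrightarrow> same_hulls a c" for a b c
    unfolding same_hulls_def by blast
  have tr': "same_hulls a b \<Longrightarrow> same_hulls b c \<Longrightarrow> same_hulls a c" for a b c
    unfolding same_hulls_def by blast
  have "min (index h) (index (inv h)) = min (index g) (index (inv g))"
    using col[OF xy] unfolding colour_def g_def h_def by simp
  \<comment> \<open>Equal minima match the index of \<open>h\<close> or \<open>inv h\<close> with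
    that of \<open>g\<close> or \<open>inv g\<close>. All four lie in one hull class, where the
    index is injective.\<close>
  then consider "index h = index g" | "index h = index (inv g)"
    | "index (inv h) = index g" | "index (inv h) = index (inv g)"
    by (metis min_def)
  then have "h = g \<or> h = inv g \<or> inv h = g \<or> inv h = inv g"
    using index_inj[OF gC] index_inj[OF inv_closed[OF gC]] hg
      tr[OF hg same_hulls_inv[OF gC]] tr'[OF same_hulls_inv[OF hC] hg]
      tr[OF tr'[OF same_hulls_inv[OF hC] hg] same_hulls_inv[OF gC]]
    by metis
  then have "h = g \<or> h = inv g" using gC hC by (metis inv_inv)
  then show ?thesis by (simp add: g_def h_def)
qed

end

section \<open>The metric\<close>

lemma (in group) inversion_rigid_colouring_exists:
  "\<exists>c :: 'a \<Rightarrow> nat. (\<forall>g\<in>carrier G. c (inv g) = c g) \<and>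
    (\<forall>f. bij_betw f (carrier G) (carrier G) \<and>
      (\<forall>x\<in>carrier G. \<forall>y\<in>carrier G. c (f x \<otimes> inv (f y)) = c (x \<otimes> inv y)) \<longrightarrow>
      (\<forall>x\<in>carrier G. \<forall>y\<in>carrier G. f x \<otimes> inv (f y) \<in> {x \<otimes> inv y, inv (x \<otimes> inv y)}))"
proof -
  \<comment> \<open>The well-order lives on the whole type; \<open>below\<close> and
    \<open>upto\<close> restrict it to the carrier.\<close>
  obtain r :: "'a rel" where r: "Well_order r" "Field r = UNIV" using well_ordering[where 'a = 'a] by blast
  have wf: "wf (r - Id)" and tr: "trans r" and an: "antisym r" and tot: "total r"
    using r unfolding well_order_on_def linear_order_on_def partial_order_on_def preorder_on_def
    by simp_all
  interpret well_ordered_group G "\<lambda>x y. (x, y) \<in> r - Id"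
  proof
    have "{(x, y). (x, y) \<in> r - Id} = r - Id" by blast
    then show "wf {(x, y). (x, y) \<in> r - Id}" using wf by (simp only:)
    show "(x, z) \<in> r - Id" if "(x, y) \<in> r - Id" "(y, z) \<in> r - Id" for x y z
    proof -
      have "(x, z) \<in> r" using that transD[OF tr] by blast
      moreover have "x \<noteq> z" using that antisymD[OF an] by blast
      ultimately show ?thesis by simp
    qed
    show "(x, y) \<in> r - Id \<or> (y, x) \<in> r - Id" if "x \<noteq> y" for x y
      using that tot by (auto simp: total_on_def)
  qed
  show ?thesis
  proof (intro exI[of _ colour] conjI ballI allI impI)
    show "colour (inv g) = colour g" if "g \<in> carrier G" for g
      using that by (rule colour_inv)
    fix f x y
    assume f: "bij_betw f (carrier G) (carrier G) \<and>
      (\<forall>x\<in>carrier G. \<forall>y\<in>carrier G. colour (f x \<otimes> inv (f y)) = colour (x \<otimes> inv y))"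
      and "x \<in> carrier G" "y \<in> carrier G"
    then show "f x \<otimes> inv (f y) \<in> {x \<otimes> inv y, inv (x \<otimes> inv y)}"
      by (intro colour_preserving_quotient) blast+
  qed
qed

text \<open>The default \<open>0\<close> off the carrier keeps nonnegativity and symmetry valid for
  all arguments, as \<open>Metric_space\<close> demands.\<close>

definition colour_dist :: "('a, 'm) monoid_scheme \<Rightarrow> ('a \<Rightarrow> nat) \<Rightarrow> 'a \<Rightarrow> 'a \<Rightarrow> real" where
  "colour_dist G c x y =
    (if x \<in> carrier G \<and> y \<in> carrier G \<and> x \<noteq> y then 1 + 1 / (1 + real (c (x \<otimes>\<^bsub>G\<^esub> inv\<^bsub>G\<^esub> y))) else 0)"

lemma (in group) Metric_space_colour_dist:
  assumes c: "\<And>g. g \<in> carrier G \<Longrightarrow> c (inv g) = c g"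
  shows "Metric_space (carrier G) (colour_dist G c)"
proof
  have bound: "1 \<le> 1 + 1 / (1 + real n)" "1 + 1 / (1 + real n) \<le> 2" for n
    by (simp_all add: field_simps)
  show "0 \<le> colour_dist G c x y" for x y by (simp add: colour_dist_def)
  show "colour_dist G c x y = colour_dist G c y x" for x y
  proof (cases "x \<in> carrier G \<and> y \<in> carrier G")
    case True
    then have "c (inv (x \<otimes> inv y)) = c (x \<otimes> inv y)" by (intro c) auto
    then have "c (y \<otimes> inv x) = c (x \<otimes> inv y)" using True by (simp add: inv_mult_group)
    then show ?thesis by (auto simp: colour_dist_def)
  qed (auto simp: colour_dist_def)
  show "colour_dist G c x y = 0 \<longleftrightarrow> x = y" if "x \<in> carrier G" "y \<in> carrier G" for x y
    using that bound(1)[of "c (x \<otimes> inv y)"] unfolding colour_dist_def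
    by (metis not_one_le_zero)
  show "colour_dist G c x z \<le> colour_dist G c x y + colour_dist G c y z"
    if "x \<in> carrier G" "y \<in> carrier G" "z \<in> carrier G" for x y z
  proof -
    have "1 + 1 / (1 + real (c (x \<otimes> inv z)))
      \<le> (1 + 1 / (1 + real (c (x \<otimes> inv y)))) + (1 + 1 / (1 + real (c (y \<otimes> inv z))))"
      using bound[of "c (x \<otimes> inv y)"] bound[of "c (y \<otimes> inv z)"] bound[of "c (x \<otimes> inv z)"]
      by linarith
    then show ?thesis using that by (simp add: colour_dist_def)
  qed
qed

lemma (in group) right_invariant_colour_dist: "right_invariant G (colour_dist G c)"
  unfolding right_invariant_def
proof (intro ballI)
  fix x y g assume *: "x \<in> carrier G" "y \<in> carrier G" "g \<in> carrier G"
  then have "(x \<otimes> g) \<otimes> inv (y \<otimes> g) = x \<otimes> inv y"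
    by (intro quotient_cancel_right)
  then show "colour_dist G c (x \<otimes> g) (y \<otimes> g) = colour_dist G c x y"
    using * by (simp add: colour_dist_def)
qed

lemma (in group) isometry_colour_dist:
  assumes f: "isometry_on (carrier G) (colour_dist G c) f"
  shows "bij_betw f (carrier G) (carrier G)"
    and "\<lbrakk>x \<in> carrier G; y \<in> carrier G\<rbrakk> \<Longrightarrow> c (f x \<otimes> inv (f y)) = c (x \<otimes> inv y)"
proof -
  have im: "f ` carrier G = carrier G"
    and d: "\<And>x y. x \<in> carrier G \<Longrightarrow> y \<in> carrier G \<Longrightarrow> colour_dist G c (f x) (f y) = colour_dist G c x y"
    using f unfolding isometry_on_def by auto
  have pos: "1 + 1 / (1 + real n) \<noteq> 0" for n
    by (smt (verit) divide_nonneg_nonneg of_nat_0_le_iff)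
  have inj: "x = y" if "x \<in> carrier G" "y \<in> carrier G" "f x = f y" for x y
  proof (rule ccontr)
    assume "x \<noteq> y"
    then have "1 + 1 / (1 + real (c (x \<otimes> inv y))) = 0"
      using d[OF that(1,2)] that by (simp add: colour_dist_def)
    then show False using pos by blast
  qed
  then show "bij_betw f (carrier G) (carrier G)" using im by (auto simp: bij_betw_def inj_on_def)
  show "c (f x \<otimes> inv (f y)) = c (x \<otimes> inv y)" if "x \<in> carrier G" "y \<in> carrier G"
  proof (cases "x = y")
    case True
    then show ?thesis using that im by (metis imageI r_inv)
  next
    case False
    then have "f x \<noteq> f y" "f x \<in> carrier G" "f y \<in> carrier G" using inj that im by auto
    \<comment> \<open>Off the diagonal the distance determines the colour, since
      \<open>n \<mapsto> 1 + 1 / (1 + n)\<close> is injective.\<close>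
    then have "1 + 1 / (1 + real (c (f x \<otimes> inv (f y)))) = 1 + 1 / (1 + real (c (x \<otimes> inv y)))"
      using d[OF that] that False unfolding colour_dist_def by (simp only: if_True simp_thms)
    then show ?thesis by simp
  qed
qed

section \<open>From translations to an isomorphism of group laws\<close>

theorem corollary8p1:
  fixes G :: "('a, 'm) monoid_scheme"
  assumes "group G"
    and "\<forall>g\<in>carrier G. \<exists>h\<in>carrier G. h [^]\<^bsub>G\<^esub> (2::nat) = g"
  shows "natural_group G"
proof -
  interpret group G by fact
  have roots: "\<exists>h\<in>carrier G. h \<otimes>\<^bsub>G\<^esub> h = g" if g: "g \<in> carrier G" for g
  proof -
    obtain h where "h \<in> carrier G" "h [^]\<^bsub>G\<^esub> (2::nat) = g" using assms(2) g by blast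
    then show ?thesis by (auto simp: numeral_2_eq_2)
  qed
  obtain c :: "'a \<Rightarrow> nat"
    where c_inv: "\<And>g. g \<in> carrier G \<Longrightarrow> c (inv\<^bsub>G\<^esub> g) = c g"
      and c_rigid: "\<forall>f. bij_betw f (carrier G) (carrier G) \<and>
        (\<forall>x\<in>carrier G. \<forall>y\<in>carrier G.
          c (f x \<otimes>\<^bsub>G\<^esub> inv\<^bsub>G\<^esub> (f y)) = c (x \<otimes>\<^bsub>G\<^esub> inv\<^bsub>G\<^esub> y)) \<longrightarrow>
        (\<forall>x\<in>carrier G. \<forall>y\<in>carrier G.
          f x \<otimes>\<^bsub>G\<^esub> inv\<^bsub>G\<^esub> (f y) \<in> {x \<otimes>\<^bsub>G\<^esub> inv\<^bsub>G\<^esub> y, inv\<^bsub>G\<^esub> (x \<otimes>\<^bsub>G\<^esub> inv\<^bsub>G\<^esub> y)})"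
    using inversion_rigid_colouring_exists by blast
  let ?d = "colour_dist G c"
  have "H \<cong> G"
    if H: "group H" "carrier H = carrier G"
      and iso: "\<forall>h\<in>carrier H. isometry_on (carrier G) ?d (right_translation H h)"
    for H :: "'a monoid"
  proof -
    interpret H: group H by fact
    have transl: "x \<otimes>\<^bsub>H\<^esub> h = x \<otimes>\<^bsub>G\<^esub> (\<one>\<^bsub>G\<^esub> \<otimes>\<^bsub>H\<^esub> h)"
      if x: "x \<in> carrier G" and h: "h \<in> carrier G" for x h
    \<comment> \<open>The unit of \<open>H\<close> is set apart because its translation fixes every
      point; by cancellation in \<open>H\<close>, every other right translation has no fixed
      point.\<close>
    proof (cases "h = \<one>\<^bsub>H\<^esub>")
      case True
      then show ?thesis using x H by simp
    next
      case False
      let ?f = "right_translation H h"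
      have f: "isometry_on (carrier G) ?d ?f" using iso h H by simp
      have "?f x = x \<otimes>\<^bsub>G\<^esub> ?f \<one>\<^bsub>G\<^esub>"
      proof (rule fixed_point_free_inversion_is_translation[OF roots])
        show "?f y \<in> carrier G" if "y \<in> carrier G" for y
          using that h H by (metis H.m_closed right_translation_def)
        show "?f y \<otimes>\<^bsub>G\<^esub> inv\<^bsub>G\<^esub> (?f z) \<in> {y \<otimes>\<^bsub>G\<^esub> inv\<^bsub>G\<^esub> z, inv\<^bsub>G\<^esub> (y \<otimes>\<^bsub>G\<^esub> inv\<^bsub>G\<^esub> z)}"
          if "y \<in> carrier G" "z \<in> carrier G" for y z
          using c_rigid isometry_colour_dist[OF f] that by blast
        show "?f y \<noteq> y" if "y \<in> carrier G" for y
          using that h H False by (simp add: right_translation_def)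
      qed (use x in auto)
      then show ?thesis by (simp add: right_translation_def)
    qed
    \<comment> \<open>Left translation in \<open>H\<close> by the unit of \<open>G\<close>, hence
      bijective; it takes the unit of \<open>H\<close> to that of \<open>G\<close>. Applying
      \<open>transl\<close> to \<open>?\<phi> x\<close> and \<open>y\<close> makes it
      multiplicative.\<close>
    let ?\<phi> = "\<lambda>h. \<one>\<^bsub>G\<^esub> \<otimes>\<^bsub>H\<^esub> h"
    have one: "\<one>\<^bsub>G\<^esub> \<in> carrier H" using H by simp
    have "?\<phi> \<in> hom H G"
    proof (rule homI)
      show "?\<phi> x \<in> carrier G" if "x \<in> carrier H" for x using that one H by (metis H.m_closed)
      show "?\<phi> (x \<otimes>\<^bsub>H\<^esub> y) = ?\<phi> x \<otimes>\<^bsub>G\<^esub> ?\<phi> y" if "x \<in> carrier H" "y \<in> carrier H" for x y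
        using transl[of "?\<phi> x" y] that one H by (metis H.m_assoc H.m_closed)
    qed
    moreover have "bij_betw ?\<phi> (carrier H) (carrier G)"
      unfolding H(2)[symmetric] using one
      by (intro bij_betw_byWitness[where f' = "\<lambda>h. inv\<^bsub>H\<^esub> \<one>\<^bsub>G\<^esub> \<otimes>\<^bsub>H\<^esub> h"])
         (auto simp: H.m_assoc[symmetric])
    ultimately show ?thesis unfolding is_iso_def iso_def by blast
  qed
  then have "naturalizing G ?d"
    unfolding naturalizing_def
    using Metric_space_colour_dist[of c, OF c_inv] right_invariant_colour_dist by blast
  then show ?thesis unfolding natural_group_def using assms(1) by blast
qed

end
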